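(* Let $G=\mathbb Z_3\times\mathbb Z_6$ and let $S(G)$ be the set of integer group determinants of $G$. Let $D$ be an integer that is not of the form $3^7m$ with $3\nmid m$ (i.e. either $D=0$ or the exact power $3^{\ell}$ of $3$ dividing $D$ has $\ell\neq 7$). Then $D\in S(G)$ if and only if $D$ is of one of the following forms (with $m,k\in\mathbb Z$ arbitrary): (i) $\pm(1+18m)$; (ii) $\pm 4(4+9m)(4+9k)$; (iii) $\pm 3^6(1+6m)$ or $\pm 3^8(1+2m)$; (iv) $\pm 2^2\cdot 3^6(1+3m)(4+9k)$, or $2^2\cdot 3^8 m(4+9k)$, or $2^2\cdot 3^{12}m$. More precisely: the odd elements of $S(G)$ coprime to $3$ are exactly those in (i); the even elements coprime to $3$ are exactly those in (ii); the odd multiples of $3$ in $S(G)$ not exactly divisible by $3^7$ are exactly those in (iii); and the even multiples of $3$ in $S(G)$ not exactly divisible by $3^7$ are exactly those in (iv).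
   Context: For a finite group $G$ and an element $\sum_{g\in G}a_g g$ of the group ring $\mathbb Z[G]$ (all $a_g\in\mathbb Z$), its group determinant is $D\left(\sum_g a_g g\right)=\det\left(a_{gh^{-1}}\right)_{g,h\in G}$, with $g$ indexing rows and $h$ columns. An integer group determinant for $G$ is any integer arising this way; $S(G)$ denotes the set of all of them. Here $\mathbb Z_n$ is the cyclic group of order $n$. *)

theory Defs
  imports "HOL-Analysis.Analysis" "HOL-Library.Numeral_Type" "HOL-Library.Product_Plus"
begin

text \<open>Groups are written additively (\<^class>\<open>group_add\<close> does not assume commutativity), so
  \<open>g h\<^sup>-\<^sup>1\<close> reads \<open>g - h\<close>. A group ring element is given by its coefficient function.\<close>

definition group_det :: "('g::{finite,group_add} \<Rightarrow> int) \<Rightarrow> int" where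
  "group_det a = det (\<chi> g h. a (g - h))"

definition integer_group_dets :: "'g::{finite,group_add} itself \<Rightarrow> int set" where
  "integer_group_dets _ = range (group_det :: ('g \<Rightarrow> int) \<Rightarrow> int)"

text \<open>The numeral type \<open>n\<close> carries addition modulo \<open>n\<close>, and addition on a product type is
  componentwise.\<close>

type_synonym Z3_Z6 = "3 \<times> 6"

definition forms_i :: "int set" where
  "forms_i = {s * (1 + 18 * m) | s m. s \<in> {1, -1}}"

definition forms_ii :: "int set" where
  "forms_ii = {s * 4 * (4 + 9 * m) * (4 + 9 * k) | s m k. s \<in> {1, -1}}"

definition forms_iii :: "int set" where
  "forms_iii = {s * 3 ^ 6 * (1 + 6 * m) | s m. s \<in> {1, -1}}
             \<union> {s * 3 ^ 8 * (1 + 2 * m) | s m. s \<in> {1, -1}}"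

definition forms_iv :: "int set" where
  "forms_iv = {s * 2\<^sup>2 * 3 ^ 6 * (1 + 3 * m) * (4 + 9 * k) | s m k. s \<in> {1, -1}}
            \<union> {2\<^sup>2 * 3 ^ 8 * m * (4 + 9 * k) | m k. True}
            \<union> {2\<^sup>2 * 3 ^ 12 * m | m. True}"

definition exactly_3_pow_7 :: "int \<Rightarrow> bool" where
  "exactly_3_pow_7 D \<longleftrightarrow> (\<exists>m. D = 3 ^ 7 * m \<and> \<not> 3 dvd m)"

end

theory Submission
  imports Defs
begin

text \<open>Splitting off the characters of \<open>\<int>\<^sub>2\<close> shows that the determinants for \<open>\<int>\<^sub>3 \<times> \<int>\<^sub>6\<close> are the products
  \<open>D(u) D(v)\<close> of determinants for \<open>\<int>\<^sub>3 \<times> \<int>\<^sub>3\<close> with \<open>u\<close> and \<open>v\<close> congruent modulo 2; in particular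
  \<open>D(u)\<close> and \<open>D(v)\<close> have the same parity. Pairing complex conjugate characters,
  \<open>D(u) = s \<Prod>\<^sub>i (s\<^sup>2 - 3 q\<^sub>i)\<close>, where \<open>s\<close> is the augmentation of \<open>u\<close> and \<open>q\<^sub>1, \<dots>, q\<^sub>4\<close> are the second
  elementary symmetric functions of the images of \<open>u\<close> in the four quotients of order 3. Since
  \<open>3\<close> divides \<open>q\<^sub>1 + q\<^sub>2 + q\<^sub>3 + q\<^sub>4\<close>, either \<open>D(u) \<equiv> s\<^sup>9 \<equiv> \<plusminus>1\<close> modulo 9, or \<open>3\<close> divides \<open>s\<close>, in which
  case every \<open>q\<^sub>i\<close> is \<open>0\<close> or \<open>-1\<close> modulo 3, hence some \<open>q\<^sub>i\<close> is divisible by 3 and \<open>3\<^sup>6\<close> divides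
  \<open>D(u)\<close>. These constraints give exactly the listed forms.\<close>

section \<open>Factoring a group determinant over a table of characters\<close>

lemma of_int_det: "of_int (det A) = (det (\<chi> i j. of_int (A $ i $ j)) :: 'a :: comm_ring_1)"
  by (simp add: det_def)

text \<open>The columns of the character table are eigenvectors of the group matrix, and
  orthogonality makes the table invertible, so the determinant is the product of the eigenvalues.
  Here \<open>\<beta> x c\<close> is the value at \<open>x\<close> of the character with index
  \<open>c\<close>; indexing characters by the group itself keeps the table square.\<close>

lemma group_det_characters:
  fixes a :: "'g::{finite,group_add} \<Rightarrow> int" and \<beta> :: "'g \<Rightarrow> 'g \<Rightarrow> complex"
  assumes add: "\<And>x y c. \<beta> (x + y) c = \<beta> x c * \<beta> y c"
    and zero: "\<And>c. \<beta> 0 c = 1"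
    and orthogonal: "\<And>x. x \<noteq> 0 \<Longrightarrow> (\<Sum>c\<in>UNIV. \<beta> x c) = 0"
  shows "of_int (group_det a) = (\<Prod>c\<in>UNIV. \<Sum>k\<in>UNIV. of_int (a k) * \<beta> k c)"
proof -
  \<comment> \<open>The transpose of the group matrix: with \<open>a (h - g)\<close> the
    substitution \<open>h = k + g\<close> pulls out the factor \<open>\<beta> g c\<close>.\<close>
  define M :: "((complex, 'g) vec, 'g) vec" where "M = (\<chi> g h. of_int (a (h - g)))"
  define P :: "((complex, 'g) vec, 'g) vec" where "P = (\<chi> g c. \<beta> g c)"
  define Q :: "((complex, 'g) vec, 'g) vec" where "Q = (\<chi> c g. \<beta> (- g) c)"
  define ev where "ev c = (\<Sum>k\<in>UNIV. of_int (a k) * \<beta> k c)" for c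
  define L :: "((complex, 'g) vec, 'g) vec" where "L = (\<chi> c d. if c = d then ev c else 0)"
  have "(\<Sum>h\<in>UNIV. of_int (a (h - g)) * \<beta> h c) = \<beta> g c * ev c" for g c
  proof -
    have "(\<Sum>h\<in>UNIV. of_int (a (h - g)) * \<beta> h c) = (\<Sum>k\<in>UNIV. of_int (a k) * \<beta> (k + g) c)"
      by (rule sum.reindex_bij_witness[of _ "\<lambda>k. k + g" "\<lambda>h. h - g"]) auto
    then show ?thesis
      by (simp add: ev_def add sum_distrib_left mult_ac)
  qed
  then have "M ** P = P ** L"
    by (simp add: M_def P_def L_def matrix_matrix_mult_def vec_eq_iff if_distrib cong: if_cong)
  then have "det M * det P = det P * det L"
    by (metis det_mul)
  moreover have "det P \<noteq> 0"
  proof -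
    \<comment> \<open>Orthogonality says that \<open>P ** Q\<close> is the group order times the
      identity, so \<open>det P\<close> cannot vanish.\<close>
    have "(\<Sum>c\<in>UNIV. \<beta> g c * \<beta> (- h) c) = (if g = h then of_nat CARD('g) else 0)" for g h
      using orthogonal[of "g - h"] zero by (simp flip: add)
    then have "P ** Q = (\<chi> g h. if g = h then of_nat CARD('g) else 0)"
      by (simp add: P_def Q_def matrix_matrix_mult_def)
    moreover have "det (\<chi> g h. if g = h then of_nat CARD('g) else (0 :: complex)) \<noteq> 0"
      by (subst det_diagonal) auto
    ultimately show ?thesis
      by (metis det_mul mult_zero_left)
  qed
  ultimately have "det M = det L"
    by simp
  also have "det L = (\<Prod>c\<in>UNIV. ev c)"
    by (subst det_diagonal) (auto simp: L_def)
  also have "det M = of_int (group_det a)"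
  proof -
    have "M = transpose (\<chi> g h. of_int (a (g - h)))"
      by (simp add: M_def transpose_def)
    then show ?thesis
      by (simp add: group_det_def of_int_det)
  qed
  finally show ?thesis
    by (simp add: ev_def)
qed

text \<open>For a cyclic group seen as the ring of integers modulo n, one faithful character
  \<open>c\<close> gives every character as \<open>\<lambda>k. c (k * i)\<close>, so ring elements
  serve as indices of characters.\<close>

definition faithful_char :: "('a::ab_group_add \<Rightarrow> complex) \<Rightarrow> bool" where
  "faithful_char c \<longleftrightarrow> (\<forall>x y. c (x + y) = c x * c y) \<and> (\<forall>x. c x = 1 \<longleftrightarrow> x = 0)"

lemma faithful_char_add: "faithful_char c \<Longrightarrow> c (x + y) = c x * c y"
  and faithful_char_0: "faithful_char c \<Longrightarrow> c 0 = 1"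
  by (auto simp: faithful_char_def)

text \<open>Translating \<open>i\<close> by 1 permutes the summands and multiplies the sum by
  \<open>c k\<close>, which differs from 1 by faithfulness.\<close>

lemma sum_faithful_char_mult:
  fixes c :: "'r::{finite,comm_ring_1} \<Rightarrow> complex"
  assumes c: "faithful_char c" and "k \<noteq> 0"
  shows "(\<Sum>i\<in>UNIV. c (k * i)) = 0"
proof -
  have "(\<Sum>i\<in>UNIV. c (k * i)) = (\<Sum>i\<in>UNIV. c (k * (i + 1)))"
    by (rule sum.reindex_bij_witness[of _ "\<lambda>i. i + 1" "\<lambda>i. i - 1"]) auto
  also have "\<dots> = (\<Sum>i\<in>UNIV. c (k * i)) * c k"
    by (simp add: distrib_left faithful_char_add[OF c] sum_distrib_right)
  finally show ?thesis
    using assms by (auto simp: faithful_char_def)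
qed

lemma group_det_prod:
  fixes a :: "'r::{finite,comm_ring_1} \<times> 's::{finite,comm_ring_1} \<Rightarrow> int"
  assumes c: "faithful_char c" and d: "faithful_char d"
  shows "of_int (group_det a) =
    (\<Prod>i\<in>UNIV. \<Prod>j\<in>UNIV. \<Sum>k\<in>UNIV. \<Sum>l\<in>UNIV. of_int (a (k, l)) * (c (k * i) * d (l * j)))"
proof -
  define \<beta> :: "'r \<times> 's \<Rightarrow> 'r \<times> 's \<Rightarrow> complex"
    where "\<beta> x y = c (fst x * fst y) * d (snd x * snd y)" for x y
  have "of_int (group_det a) = (\<Prod>y\<in>UNIV. \<Sum>x\<in>UNIV. of_int (a x) * \<beta> x y)"
  proof (rule group_det_characters)
    fix x :: "'r \<times> 's" assume "x \<noteq> 0"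
    have "(\<Sum>y\<in>UNIV. \<beta> x y) = (\<Sum>i\<in>UNIV. c (fst x * i)) * (\<Sum>j\<in>UNIV. d (snd x * j))"
      by (simp add: \<beta>_def sum_product sum.cartesian_product split_beta flip: UNIV_Times_UNIV)
    moreover have "fst x \<noteq> 0 \<or> snd x \<noteq> 0"
      using \<open>x \<noteq> 0\<close> by (simp add: prod_eq_iff)
    ultimately show "(\<Sum>y\<in>UNIV. \<beta> x y) = 0"
      using sum_faithful_char_mult[OF c] sum_faithful_char_mult[OF d] by auto
  qed (simp_all add: \<beta>_def distrib_right faithful_char_add[OF c] faithful_char_add[OF d]
        faithful_char_0[OF c] faithful_char_0[OF d])
  then show ?thesis
    by (simp add: \<beta>_def sum.cartesian_product prod.cartesian_product split_beta flip: UNIV_Times_UNIV)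
qed

section \<open>Explicit characters of the cyclic groups of orders 3 and 6\<close>

definition \<omega> :: complex where "\<omega> = cis (2 * pi / 3)"

lemma omega_cube: "\<omega> ^ 3 = 1"
  by (simp add: \<omega>_def Complex.DeMoivre)

lemma omega_neq_1: "\<omega> \<noteq> 1"
  by (simp add: \<omega>_def complex_eq_iff cos_120)

lemma omega_sq: "\<omega>\<^sup>2 = - 1 - \<omega>"
proof -
  have "(\<omega> - 1) * (\<omega>\<^sup>2 + \<omega> + 1) = \<omega> ^ 3 - 1"
    by algebra
  then have "\<omega>\<^sup>2 + \<omega> + 1 = 0"
    using omega_neq_1 omega_cube by simp
  then show ?thesis by algebra
qed

lemma power_mod_order:
  fixes z :: "'a::monoid_mult"
  assumes "z ^ n = 1" shows "z ^ (k mod n) = z ^ k"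
proof -
  have "z ^ k = z ^ (n * (k div n) + k mod n)"
    by simp
  also have "\<dots> = z ^ (k mod n)"
    by (simp only: power_add power_mult assms power_one mult_1)
  finally show ?thesis ..
qed

definition chr3 :: "3 \<Rightarrow> complex" where "chr3 x = \<omega> ^ nat (Rep_bit1 x)"
text \<open>The base \<open>- \<omega>\<close> is a primitive sixth root of unity with
  \<open>chr6 4 = \<omega>\<close> and \<open>chr6 3 = - 1\<close>; hence \<open>chr6\<close>
  matches \<open>chr3\<close> along \<open>emb_Z3_Z6\<close> below.\<close>

definition chr6 :: "6 \<Rightarrow> complex" where "chr6 x = (- \<omega>) ^ nat (Rep_bit0 x)"

lemma UNIV_3': "(UNIV :: 3 set) = {0, 1, 2}"
proof -
  have "x \<in> {0, 1, 2}" for x :: 3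
  proof (induct x)
    case (of_int z)
    then have "z = 0 \<or> z = 1 \<or> z = 2" by fastforce
    then show ?case by auto
  qed
  then show ?thesis by blast
qed

lemma UNIV_6: "(UNIV :: 6 set) = {0, 1, 2, 3, 4, 5}"
proof -
  have "x \<in> {0, 1, 2, 3, 4, 5}" for x :: 6
  proof (induct x)
    case (of_int z)
    then have "z = 0 \<or> z = 1 \<or> z = 2 \<or> z = 3 \<or> z = 4 \<or> z = 5" by fastforce
    then show ?case by auto
  qed
  then show ?thesis by blast
qed

lemma chr3_simps: "chr3 0 = 1" "chr3 1 = \<omega>" "chr3 2 = \<omega>\<^sup>2"
  by (simp_all add: chr3_def bit1.Rep_0 bit1.Rep_1 bit1.Rep_numeral)

lemma chr6_simps:
  "chr6 0 = 1" "chr6 1 = - \<omega>" "chr6 2 = \<omega>\<^sup>2" "chr6 3 = - 1" "chr6 4 = \<omega>" "chr6 5 = - \<omega>\<^sup>2"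
proof -
  have "\<omega> ^ 4 = \<omega>" "\<omega> ^ 5 = \<omega>\<^sup>2"
    using omega_cube by algebra+
  then show "chr6 0 = 1" "chr6 1 = - \<omega>" "chr6 2 = \<omega>\<^sup>2" "chr6 3 = - 1" "chr6 4 = \<omega>" "chr6 5 = - \<omega>\<^sup>2"
    by (simp_all add: chr6_def bit0.Rep_0 bit0.Rep_1 bit0.Rep_numeral omega_cube)
qed

lemma faithful_chr3: "faithful_char chr3"
  unfolding faithful_char_def
proof (intro conjI allI)
  fix x y :: 3
  have "nat (Rep_bit1 (x + y)) = (nat (Rep_bit1 x) + nat (Rep_bit1 y)) mod 3"
    using Rep_bit1[of x] Rep_bit1[of y] bit1.Rep_Abs_mod[where 'a=num1, of "Rep_bit1 x + Rep_bit1 y"]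
    by (simp add: bit1.add_def nat_mod_distrib nat_add_distrib)
  then show "chr3 (x + y) = chr3 x * chr3 y"
    by (simp add: chr3_def power_mod_order[OF omega_cube] power_add)
next
  fix x :: 3
  have "x \<in> {0, 1, 2}" unfolding UNIV_3'[symmetric] by simp
  moreover have "\<omega>\<^sup>2 \<noteq> 1"
    using omega_neq_1 omega_cube by (auto simp: power3_eq_cube power2_eq_square)
  ultimately show "chr3 x = 1 \<longleftrightarrow> x = 0"
    using omega_neq_1 by (auto simp: chr3_simps)
qed

lemma faithful_chr6: "faithful_char chr6"
  unfolding faithful_char_def
proof (intro conjI allI)
  fix x y :: 6
  have *: "(- \<omega>) ^ 6 = 1"
    using omega_cube by algebra
  have "nat (Rep_bit0 (x + y)) = (nat (Rep_bit0 x) + nat (Rep_bit0 y)) mod 6"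
    using Rep_bit0[of x] Rep_bit0[of y] bit0.Rep_Abs_mod[where 'a=3, of "Rep_bit0 x + Rep_bit0 y"]
    by (simp add: bit0.add_def nat_mod_distrib nat_add_distrib)
  then show "chr6 (x + y) = chr6 x * chr6 y"
    by (simp add: chr6_def power_mod_order[OF *] power_add)
next
  fix x :: 6
  have "x \<in> {0, 1, 2, 3, 4, 5}" unfolding UNIV_6[symmetric] by simp
  moreover have "\<omega>\<^sup>2 \<noteq> 1"
    using omega_neq_1 omega_cube by (auto simp: power3_eq_cube power2_eq_square)
  moreover have "(- \<omega>) ^ 3 = - 1"
    using omega_cube by simp
  then have "- \<omega> \<noteq> 1"
    by (metis one_neq_neg_one power_one)
  moreover have "- \<omega>\<^sup>2 \<noteq> 1"
    using omega_sq omega_cube omega_neq_1 by auto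
  ultimately show "chr6 x = 1 \<longleftrightarrow> x = 0"
    using omega_neq_1 by (auto simp: chr6_simps)
qed

section \<open>Splitting off the factor of order 2 in the cyclic group of order 6\<close>

lemma sum_UNIV_3: "(\<Sum>t\<in>UNIV. f t) = f 0 + f 1 + f 2"
  for f :: "3 \<Rightarrow> 'a::comm_monoid_add"
  unfolding UNIV_3' by (simp add: add.assoc)

lemma sum_UNIV_6: "(\<Sum>t\<in>UNIV. f t) = f 0 + f 1 + f 2 + f 3 + f 4 + f 5"
  for f :: "6 \<Rightarrow> 'a::comm_monoid_add"
  unfolding UNIV_6 by (simp add: add.assoc)

lemma prod_UNIV_3: "(\<Prod>t\<in>UNIV. f t) = f 0 * f 1 * f 2"
  for f :: "3 \<Rightarrow> 'a::comm_monoid_mult"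
  unfolding UNIV_3' by (simp add: mult.assoc)

lemma prod_UNIV_6: "(\<Prod>t\<in>UNIV. f t) = f 0 * f 1 * f 2 * f 3 * f 4 * f 5"
  for f :: "6 \<Rightarrow> 'a::comm_monoid_mult"
  unfolding UNIV_6 by (simp add: mult.assoc)

text \<open>The even element of \<open>\<int>\<^sub>6\<close> that is congruent to \<open>t\<close> modulo 3. By the Chinese remainder theorem
  every element of \<open>\<int>\<^sub>6\<close> is \<open>emb_Z3_Z6 t\<close> or \<open>emb_Z3_Z6 t + 3\<close> for a unique \<open>t\<close>.\<close>

definition emb_Z3_Z6 :: "3 \<Rightarrow> 6" where "emb_Z3_Z6 t = (if t = 0 then 0 else if t = 1 then 4 else 2)"

lemma emb_Z3_Z6_simps: "emb_Z3_Z6 0 = 0" "emb_Z3_Z6 1 = 4" "emb_Z3_Z6 2 = 2"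
  by (simp_all add: emb_Z3_Z6_def)

lemma sum_UNIV_6_emb: "(\<Sum>l\<in>UNIV. f l) = (\<Sum>t\<in>UNIV. f (emb_Z3_Z6 t) + f (emb_Z3_Z6 t + 3))"
  for f :: "6 \<Rightarrow> 'a::comm_monoid_add"
proof -
  \<comment> \<open>The numeral 7 arises as \<open>emb_Z3_Z6 1 + 3\<close>.\<close>
  have "(7 :: 6) = 1" by simp
  note [simp] = this
  show ?thesis
    by (simp add: sum_UNIV_3 sum_UNIV_6 emb_Z3_Z6_simps add.assoc add.commute add.left_commute)
qed

lemma prod_UNIV_6_emb: "(\<Prod>l\<in>UNIV. f l) = (\<Prod>t\<in>UNIV. f (emb_Z3_Z6 t) * f (emb_Z3_Z6 t + 3))"
  for f :: "6 \<Rightarrow> 'a::comm_monoid_mult"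
proof -
  have "(7 :: 6) = 1" by simp
  note [simp] = this
  show ?thesis
    by (simp add: prod_UNIV_3 prod_UNIV_6 emb_Z3_Z6_simps mult.assoc mult.commute mult.left_commute)
qed

text \<open>In the ring of integers modulo 6, 3 and 4 are orthogonal idempotents. Mixed products
  therefore vanish, and the sign \<open>chr6 3 = - 1\<close> survives only when both arguments carry
  the summand 3.\<close>

lemma chr6_emb_mult:
  "chr6 (emb_Z3_Z6 t * emb_Z3_Z6 j) = chr3 (t * j)" "chr6 (emb_Z3_Z6 t * (emb_Z3_Z6 j + 3)) = chr3 (t * j)"
  "chr6 ((emb_Z3_Z6 t + 3) * emb_Z3_Z6 j) = chr3 (t * j)"
    "chr6 ((emb_Z3_Z6 t + 3) * (emb_Z3_Z6 j + 3)) = - chr3 (t * j)"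
proof -
  have t: "t \<in> {0, 1, 2}" and j: "j \<in> {0, 1, 2}"
    unfolding UNIV_3'[symmetric] by simp_all
  have m: "(4 :: 3) = 1" "(16 :: 6) = 4" "(8 :: 6) = 2" by simp_all
  show 1: "chr6 (emb_Z3_Z6 t * emb_Z3_Z6 j) = chr3 (t * j)"
    using t j by (auto simp: emb_Z3_Z6_def m chr6_simps chr3_simps)
  have "emb_Z3_Z6 t * 3 = 0" "3 * emb_Z3_Z6 j = 0"
    using t j by (auto simp: emb_Z3_Z6_def)
  moreover have "(3 * 3 :: 6) = 3" by simp
  ultimately show "chr6 (emb_Z3_Z6 t * (emb_Z3_Z6 j + 3)) = chr3 (t * j)"
    "chr6 ((emb_Z3_Z6 t + 3) * emb_Z3_Z6 j) = chr3 (t * j)"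
    "chr6 ((emb_Z3_Z6 t + 3) * (emb_Z3_Z6 j + 3)) = - chr3 (t * j)"
    using 1 by (simp_all only: distrib_left distrib_right faithful_char_add[OF faithful_chr6]
        chr6_simps) simp_all
qed

text \<open>Characters with index \<open>emb_Z3_Z6 j\<close> are trivial on the element 3 and see
  only the sum over each coset of \<open>{0, 3}\<close>; those with index
  \<open>emb_Z3_Z6 j + 3\<close> see only the difference.\<close>

lemma group_det_Z3_Z6:
  fixes a :: "3 \<times> 6 \<Rightarrow> int"
  shows "group_det a =
    group_det (\<lambda>(k, t). a (k, emb_Z3_Z6 t) + a (k, emb_Z3_Z6 t + 3)) *
    group_det (\<lambda>(k, t). a (k, emb_Z3_Z6 t) - a (k, emb_Z3_Z6 t + 3))" (is "_ = group_det ?u * group_det ?v")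
proof -
  have "(of_int (group_det a) :: complex) = of_int (group_det ?u) * of_int (group_det ?v)"
    unfolding group_det_prod[OF faithful_chr3 faithful_chr6]
      group_det_prod[OF faithful_chr3 faithful_chr3] prod_UNIV_6_emb sum_UNIV_6_emb chr6_emb_mult
    by (simp only: prod.distrib prod.case of_int_add of_int_minus diff_conv_add_uminus
        distrib_right mult_minus_left mult_minus_right)
  then show ?thesis
    by (simp only: of_int_eq_iff flip: of_int_mult)
qed

section \<open>The determinant for the product of two groups of order 3\<close>

definition Z3_norm :: "int \<Rightarrow> int \<Rightarrow> int \<Rightarrow> int" where
  "Z3_norm A B C = A\<^sup>2 + B\<^sup>2 + C\<^sup>2 - A * B - B * C - C * A"

text \<open>This is the norm of the Eisenstein integer
  \<open>A + B * \<omega> + C * \<omega>\<^sup>2\<close>: the two factors are complex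
  conjugates.\<close>

lemma Z3_norm_factor:
  "(of_int (Z3_norm A B C) :: complex) =
    (of_int A + of_int B * \<omega> + of_int C * \<omega>\<^sup>2) * (of_int A + of_int B * \<omega>\<^sup>2 + of_int C * \<omega>)"
  unfolding Z3_norm_def of_int_add of_int_diff of_int_mult of_int_power using omega_sq by algebra

text \<open>The trivial character gives the augmentation. The other eight form four conjugate pairs,
  \<open>(i, j)\<close> with \<open>(- i, - j)\<close>; a pair shares a kernel of order 3, and the
  arguments of its norm are the coefficient sums over the cosets of that kernel.\<close>

lemma group_det_Z3_Z3:
  fixes u :: "3 \<times> 3 \<Rightarrow> int"
  shows "group_det u =
    (u (0,0) + u (0,1) + u (0,2) + u (1,0) + u (1,1) + u (1,2) + u (2,0) + u (2,1) + u (2,2)) *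
    Z3_norm (u (0,0) + u (0,1) + u (0,2)) (u (1,0) + u (1,1) + u (1,2)) (u (2,0) + u (2,1) + u (2,2)) *
    Z3_norm (u (0,0) + u (1,0) + u (2,0)) (u (0,1) + u (1,1) + u (2,1)) (u (0,2) + u (1,2) + u (2,2)) *
    Z3_norm (u (0,0) + u (1,2) + u (2,1)) (u (1,0) + u (0,1) + u (2,2)) (u (2,0) + u (1,1) + u (0,2)) *
    Z3_norm (u (0,0) + u (1,1) + u (2,2)) (u (1,0) + u (0,2) + u (2,1)) (u (2,0) + u (0,1) + u (1,2))"
    (is "_ = ?s * ?N1 * ?N2 * ?N3 * ?N4")
proof -
  define E where "E i j = (\<Sum>k\<in>UNIV. \<Sum>l\<in>UNIV. complex_of_int (u (k, l)) * (chr3 (k * i) * chr3 (l * j)))"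
    for i j
  have E: "E i j = (\<Sum>k\<in>UNIV. \<Sum>l\<in>UNIV. of_int (u (k, l)) * chr3 (k * i + l * j))"
    for i j
    by (simp only: E_def faithful_char_add[OF faithful_chr3])
  have m: "(3 :: 3) = 0" "(4 :: 3) = 1" "(5 :: 3) = 2" "(6 :: 3) = 0" "(8 :: 3) = 2" by simp_all
  note simps = E sum_UNIV_3 m chr3_simps distrib_right add_ac
  have "E 0 0 = of_int ?s"
    by (simp add: simps)
  moreover have
    "E 1 0 = of_int (u (0,0) + u (0,1) + u (0,2)) + of_int (u (1,0) + u (1,1) + u (1,2)) * \<omega> +
      of_int (u (2,0) + u (2,1) + u (2,2)) * \<omega>\<^sup>2"
    "E 2 0 = of_int (u (0,0) + u (0,1) + u (0,2)) + of_int (u (1,0) + u (1,1) + u (1,2)) * \<omega>\<^sup>2 + of_int (u (2,0) + u (2,1) + u (2,2)) * \<omega>"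
    by (simp_all add: simps)
  then have "E 1 0 * E 2 0 = of_int ?N1"
    by (simp only: Z3_norm_factor)
  moreover have
    "E 0 1 = of_int (u (0,0) + u (1,0) + u (2,0)) + of_int (u (0,1) + u (1,1) + u (2,1)) * \<omega> +
      of_int (u (0,2) + u (1,2) + u (2,2)) * \<omega>\<^sup>2"
    "E 0 2 = of_int (u (0,0) + u (1,0) + u (2,0)) + of_int (u (0,1) + u (1,1) + u (2,1)) * \<omega>\<^sup>2 + of_int (u (0,2) + u (1,2) + u (2,2)) * \<omega>"
    by (simp_all add: simps)
  then have "E 0 1 * E 0 2 = of_int ?N2"
    by (simp only: Z3_norm_factor)
  moreover have
    "E 1 1 = of_int (u (0,0) + u (1,2) + u (2,1)) + of_int (u (1,0) + u (0,1) + u (2,2)) * \<omega> +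
      of_int (u (2,0) + u (1,1) + u (0,2)) * \<omega>\<^sup>2"
    "E 2 2 = of_int (u (0,0) + u (1,2) + u (2,1)) + of_int (u (1,0) + u (0,1) + u (2,2)) * \<omega>\<^sup>2 + of_int (u (2,0) + u (1,1) + u (0,2)) * \<omega>"
    by (simp_all add: simps)
  then have "E 1 1 * E 2 2 = of_int ?N3"
    by (simp only: Z3_norm_factor)
  moreover have
    "E 1 2 = of_int (u (0,0) + u (1,1) + u (2,2)) + of_int (u (1,0) + u (0,2) + u (2,1)) * \<omega> +
      of_int (u (2,0) + u (0,1) + u (1,2)) * \<omega>\<^sup>2"
    "E 2 1 = of_int (u (0,0) + u (1,1) + u (2,2)) + of_int (u (1,0) + u (0,2) + u (2,1)) * \<omega>\<^sup>2 + of_int (u (2,0) + u (0,1) + u (1,2)) * \<omega>"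
    by (simp_all add: simps)
  then have "E 1 2 * E 2 1 = of_int ?N4"
    by (simp only: Z3_norm_factor)
  ultimately have "E 0 0 * (E 1 0 * E 2 0) * (E 0 1 * E 0 2) * (E 1 1 * E 2 2) * (E 1 2 * E 2 1) =
      of_int (?s * ?N1 * ?N2 * ?N3 * ?N4)"
    by (simp only: of_int_mult)
  moreover have "of_int (group_det u) = (\<Prod>i\<in>UNIV. \<Prod>j\<in>UNIV. E i j)"
    by (simp add: group_det_prod[OF faithful_chr3 faithful_chr3] E_def)
  then have "of_int (group_det u) =
      E 0 0 * (E 1 0 * E 2 0) * (E 0 1 * E 0 2) * (E 1 1 * E 2 2) * (E 1 2 * E 2 1)"
    by (simp add: prod_UNIV_3 mult_ac)
  ultimately have "complex_of_int (group_det u) = of_int (?s * ?N1 * ?N2 * ?N3 * ?N4)"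
    by (simp only:)
  then show ?thesis
    by (simp only: of_int_eq_iff)
qed

definition coeff_sum :: "(3 \<times> 3 \<Rightarrow> int) \<Rightarrow> int" where
  "coeff_sum u = u (0,0) + u (0,1) + u (0,2) + u (1,0) + u (1,1) + u (1,2) + u (2,0) + u (2,1) + u (2,2)"

definition norm_prod :: "(3 \<times> 3 \<Rightarrow> int) \<Rightarrow> int" where
  "norm_prod u =
    Z3_norm (u (0,0) + u (0,1) + u (0,2)) (u (1,0) + u (1,1) + u (1,2)) (u (2,0) + u (2,1) + u (2,2)) *
    Z3_norm (u (0,0) + u (1,0) + u (2,0)) (u (0,1) + u (1,1) + u (2,1)) (u (0,2) + u (1,2) + u (2,2)) *
    Z3_norm (u (0,0) + u (1,2) + u (2,1)) (u (1,0) + u (0,1) + u (2,2)) (u (2,0) + u (1,1) + u (0,2)) *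
    Z3_norm (u (0,0) + u (1,1) + u (2,2)) (u (1,0) + u (0,2) + u (2,1)) (u (2,0) + u (0,1) + u (1,2))"

lemma group_det_eq_sum_norm: "group_det u = coeff_sum u * norm_prod u"
  by (simp only: group_det_Z3_Z3 coeff_sum_def norm_prod_def mult.assoc)

text \<open>Since \<open>1 + \<omega> + \<omega>\<^sup>2 = 0\<close>, a common summand cancels in
  both conjugate factors.\<close>

lemma Z3_norm_shift: "Z3_norm (A + j) (B + j) (C + j) = Z3_norm A B C"
  unfolding Z3_norm_def by algebra

lemma Z3_norm_minus: "Z3_norm (- A) (- B) (- C) = Z3_norm A B C"
  unfolding Z3_norm_def by algebra

lemma group_det_shift: "group_det (\<lambda>x. u x + j) = (coeff_sum u + 9 * j) * norm_prod u"
proof -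
  have "a + j + (b + j) + (c + j) = (a + b + c) + 3 * j" for a b c :: int
    by simp
  then have "norm_prod (\<lambda>x. u x + j) = norm_prod u"
    by (simp only: norm_prod_def Z3_norm_shift)
  moreover have "coeff_sum (\<lambda>x. u x + j) = coeff_sum u + 9 * j"
    by (simp add: coeff_sum_def)
  ultimately show ?thesis
    by (simp only: group_det_eq_sum_norm)
qed

lemma group_det_uminus: "group_det (\<lambda>x. - u x) = - group_det u" for u :: "3 \<times> 3 \<Rightarrow> int"
proof -
  have "- a + - b + - c = - (a + b + c)" for a b c :: int
    by simp
  then have "norm_prod (\<lambda>x. - u x) = norm_prod u"
    by (simp only: norm_prod_def Z3_norm_minus)
  moreover have "coeff_sum (\<lambda>x. - u x) = - coeff_sum u"
    by (simp add: coeff_sum_def)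
  ultimately show ?thesis
    by (simp add: group_det_eq_sum_norm)
qed

section \<open>Congruence and divisibility restrictions\<close>

lemma Z3_norm_eq: "Z3_norm A B C = (A + B + C)\<^sup>2 - 3 * (A * B + B * C + C * A)"
  unfolding Z3_norm_def by algebra

text \<open>Eliminating \<open>C\<close> turns the expression into minus the square of
  \<open>A - B\<close> modulo 3, and 2 is not a square modulo 3.\<close>

lemma pair_sum_mod_3:
  fixes A B C :: int
  assumes "3 dvd A + B + C"
  shows "(A * B + B * C + C * A) mod 3 \<in> {0, 2}"
proof -
  obtain t where "A + B + C = 3 * t"
    using assms by blast
  then have "A * B + B * C + C * A = 3 * ((A + B) * t - A * B) - (A - B)\<^sup>2"
    by algebra
  moreover have "(A - B) mod 3 = 0 \<or> (A - B) mod 3 = 1 \<or> (A - B) mod 3 = 2"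
    by presburger
  then have "(A - B)\<^sup>2 mod 3 \<in> {0, 1}"
    by (auto simp flip: power_mod[of "A - B"])
  ultimately show ?thesis
    by auto presburger+
qed

text \<open>Two distinct elements of \<open>\<int>\<^sub>3 \<times> \<int>\<^sub>3\<close> have different images in exactly three of the four
  quotients of order 3, so the \<open>q\<^sub>i\<close> add up to three times the second elementary symmetric function
  of the coefficients of \<open>u\<close>; the latter is \<open>q\<^sub>1\<close> plus the contributions of pairs within a row.\<close>

lemma group_det_Z3_Z3_cases:
  fixes u :: "3 \<times> 3 \<Rightarrow> int"
  obtains s q1 q2 q3 q4 :: int
  where "group_det u = s * (s\<^sup>2 - 3 * q1) * (s\<^sup>2 - 3 * q2) * (s\<^sup>2 - 3 * q3) * (s\<^sup>2 - 3 * q4)"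
    and "3 dvd q1 + q2 + q3 + q4"
    and "3 dvd s \<longrightarrow> q1 mod 3 \<in> {0, 2} \<and> q2 mod 3 \<in> {0, 2} \<and> q3 mod 3 \<in> {0, 2} \<and> q4 mod 3 \<in> {0, 2}"
proof -
  define q where "q A B C = A * B + B * C + C * A" for A B C :: int
  define q1 where "q1 = q (u (0,0) + u (0,1) + u (0,2)) (u (1,0) + u (1,1) + u (1,2)) (u (2,0) + u (2,1) + u (2,2))"
  define q2 where "q2 = q (u (0,0) + u (1,0) + u (2,0)) (u (0,1) + u (1,1) + u (2,1)) (u (0,2) + u (1,2) + u (2,2))"
  define q3 where "q3 = q (u (0,0) + u (1,2) + u (2,1)) (u (1,0) + u (0,1) + u (2,2)) (u (2,0) + u (1,1) + u (0,2))"
  define q4 where "q4 = q (u (0,0) + u (1,1) + u (2,2)) (u (1,0) + u (0,2) + u (2,1)) (u (2,0) + u (0,1) + u (1,2))"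
  have Z: "Z3_norm A B C = (coeff_sum u)\<^sup>2 - 3 * q A B C" if "A + B + C = coeff_sum u" for A B C
    using that by (simp add: Z3_norm_eq q_def)
  have qmod: "q A B C mod 3 \<in> {0, 2}" if "3 dvd coeff_sum u" "A + B + C = coeff_sum u" for A B C
    unfolding q_def using that by (intro pair_sum_mod_3) simp
  show thesis
  proof
    show "group_det u = coeff_sum u * ((coeff_sum u)\<^sup>2 - 3 * q1) * ((coeff_sum u)\<^sup>2 - 3 * q2) *
        ((coeff_sum u)\<^sup>2 - 3 * q3) * ((coeff_sum u)\<^sup>2 - 3 * q4)"
      unfolding group_det_eq_sum_norm norm_prod_def q1_def q2_def q3_def q4_def
      by (subst (1 2 3 4) Z) (simp_all add: coeff_sum_def mult.assoc)
    show "3 dvd q1 + q2 + q3 + q4"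
    proof -
      have "q (a + b + c) (d + e + f) (g + h + i) + q (a + d + g) (b + e + h) (c + f + i) +
          q (a + f + h) (d + b + i) (g + e + c) + q (a + e + i) (d + c + h) (g + b + f) =
          3 * (q (a + b + c) (d + e + f) (g + h + i) + q a b c + q d e f + q g h i)"
        for a b c d e f g h i
        unfolding q_def by algebra
      then show ?thesis
        unfolding q1_def q2_def q3_def q4_def by (simp only: dvd_triv_left)
    qed
    show "3 dvd coeff_sum u \<longrightarrow>
        q1 mod 3 \<in> {0, 2} \<and> q2 mod 3 \<in> {0, 2} \<and> q3 mod 3 \<in> {0, 2} \<and> q4 mod 3 \<in> {0, 2}"
      unfolding q1_def q2_def q3_def q4_def
      by (intro impI conjI qmod) (assumption | simp add: coeff_sum_def)+
  qed
qed

lemma group_det_Z3_Z3_mod_9: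
  fixes u :: "3 \<times> 3 \<Rightarrow> int"
  assumes "\<not> 3 dvd group_det u"
  shows "group_det u mod 9 \<in> {1, 8}"
proof -
  obtain s q1 q2 q3 q4 :: int
    where D: "group_det u = s * (s\<^sup>2 - 3 * q1) * (s\<^sup>2 - 3 * q2) * (s\<^sup>2 - 3 * q3) * (s\<^sup>2 - 3 * q4)"
      and "3 dvd q1 + q2 + q3 + q4"
    by (rule group_det_Z3_Z3_cases[of u])
  then obtain t where t: "q1 + q2 + q3 + q4 = 3 * t"
    by blast
  \<comment> \<open>Expansion in the elementary symmetric functions of the \<open>q\<close>s. Apart
    from \<open>s ^ 9\<close>, only the linear term lacks an explicit factor 9, and it gains one
    from \<open>3 dvd q1 + q2 + q3 + q4\<close>.\<close>
  have "s * (s\<^sup>2 - 3 * q1) * (s\<^sup>2 - 3 * q2) * (s\<^sup>2 - 3 * q3) * (s\<^sup>2 - 3 * q4) = s ^ 9 - 3 * s ^ 7 * (q1 + q2 + q3 + q4) +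
      9 * (s ^ 5 * (q1 * q2 + q1 * q3 + q1 * q4 + q2 * q3 + q2 * q4 + q3 * q4)
        - 3 * s ^ 3 * (q1 * q2 * q3 + q1 * q2 * q4 + q1 * q3 * q4 + q2 * q3 * q4) + 9 * s * (q1 * q2 * q3 * q4))"
    by algebra
  then have "group_det u = s ^ 9 + 9 * (s ^ 5 * (q1 * q2 + q1 * q3 + q1 * q4 + q2 * q3 + q2 * q4 + q3 * q4)
        - 3 * s ^ 3 * (q1 * q2 * q3 + q1 * q2 * q4 + q1 * q3 * q4 + q2 * q3 * q4) + 9 * s * (q1 * q2 * q3 * q4) - s ^ 7 * t)"
    unfolding D t by algebra
  then have mod9: "group_det u mod 9 = s ^ 9 mod 9"
    by (simp only: mod_mult_self2)
  have "\<not> 3 dvd s"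
    using assms by (auto simp: D)
  then have "s mod 9 = 1 \<or> s mod 9 = 2 \<or> s mod 9 = 4 \<or> s mod 9 = 5 \<or> s mod 9 = 7 \<or> s mod 9 = 8"
    by presburger
  then show ?thesis
    unfolding mod9 by (auto simp flip: power_mod[of s])
qed

lemma group_det_Z3_Z3_3_pow_6:
  fixes u :: "3 \<times> 3 \<Rightarrow> int"
  assumes "3 dvd group_det u"
  shows "3 ^ 6 dvd group_det u"
proof -
  obtain s q1 q2 q3 q4 :: int
    where D: "group_det u = s * (s\<^sup>2 - 3 * q1) * (s\<^sup>2 - 3 * q2) * (s\<^sup>2 - 3 * q3) * (s\<^sup>2 - 3 * q4)"
      and sum: "3 dvd q1 + q2 + q3 + q4"
      and q: "3 dvd s \<longrightarrow> q1 mod 3 \<in> {0, 2} \<and> q2 mod 3 \<in> {0, 2} \<and> q3 mod 3 \<in> {0, 2} \<and> q4 mod 3 \<in> {0, 2}"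
    by (rule group_det_Z3_Z3_cases[of u])
  have p: "prime (3 :: int)" by simp
  have "3 dvd s\<^sup>2 - 3 * r \<Longrightarrow> 3 dvd s" for r
    using prime_dvd_power[OF p, of s 2] by (metis dvd_diffD1 dvd_triv_left dvd_diff_right_iff dvd_diff_left_iff)
  then have "3 dvd s"
    using assms unfolding D prime_dvd_mult_iff[OF p] by blast
  then obtain t where t: "s = 3 * t"
    by blast
  \<comment> \<open>Five factors 3 come from \<open>s\<close> and the four norms. The sixth comes
    from here: four residues equal to 2 would add up to 8, which is not a multiple of 3.\<close>
  have "3 dvd q1 \<or> 3 dvd q2 \<or> 3 dvd q3 \<or> 3 dvd q4"
  proof (rule ccontr)
    assume "\<not> ?thesis"
    then have "q1 mod 3 = 2" "q2 mod 3 = 2" "q3 mod 3 = 2" "q4 mod 3 = 2"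
      using q \<open>3 dvd s\<close> by (auto simp: dvd_eq_mod_eq_0)
    with sum show False by presburger
  qed
  then have "3 dvd t * (3 * t\<^sup>2 - q1) * (3 * t\<^sup>2 - q2) * (3 * t\<^sup>2 - q3) * (3 * t\<^sup>2 - q4)"
    by (auto intro: dvd_mult dvd_mult2)
  then have "3 ^ 5 * 3 dvd 3 ^ 5 * (t * (3 * t\<^sup>2 - q1) * (3 * t\<^sup>2 - q2) * (3 * t\<^sup>2 - q3) * (3 * t\<^sup>2 - q4))"
    by (intro mult_dvd_mono dvd_refl)
  moreover have "group_det u = 3 ^ 5 * (t * (3 * t\<^sup>2 - q1) * (3 * t\<^sup>2 - q2) * (3 * t\<^sup>2 - q3) * (3 * t\<^sup>2 - q4))"
    unfolding D t by algebra
  ultimately show ?thesis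
    by simp
qed

text \<open>The determinant is a polynomial with integer coefficients in the values of
  \<open>u\<close>. With modulus 2 this gives the two factors of a determinant the same
  parity.\<close>

lemma group_det_mod:
  assumes "\<And>x. u x mod n = v x mod n"
  shows "group_det u mod n = group_det v mod n"
proof -
  have "(of_int (sign p) * (\<Prod>i\<in>UNIV. w (i - p i))) mod n = (of_int (sign p) * ((\<Prod>i\<in>UNIV. w (i - p i) mod n) mod n)) mod n"
    for p :: "'a \<Rightarrow> 'a" and w
    by (simp add: mod_prod_eq mod_mult_right_eq)
  then show ?thesis
    unfolding group_det_def det_def vec_lambda_beta
    by (subst (1 2) mod_sum_eq[symmetric]) (simp add: assms)
qed

section \<open>Determinants as products over pairs congruent modulo 2\<close>

definition proj_Z6_Z3 :: "6 \<Rightarrow> 3" where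
  "proj_Z6_Z3 l = (if l = 0 \<or> l = 3 then 0 else if l = 4 \<or> l = 1 then 1 else 2)"

text \<open>Reduction modulo 3 together with membership in the even subgroup
  \<open>range emb_Z3_Z6\<close> determines an element of the group of order 6, so a function can be
  prescribed on both cosets separately.\<close>

lemma proj_Z6_Z3_emb: "proj_Z6_Z3 (emb_Z3_Z6 t) = t" "proj_Z6_Z3 (emb_Z3_Z6 t + 3) = t" "emb_Z3_Z6 t + 3 \<notin> range emb_Z3_Z6"
proof -
  have t: "t \<in> {0, 1, 2}" unfolding UNIV_3'[symmetric] by simp
  have "(7 :: 6) = 1" by simp
  note [simp] = this
  have r: "range emb_Z3_Z6 = {0, 4, 2}"
    unfolding UNIV_3' by (simp add: emb_Z3_Z6_simps)
  show "proj_Z6_Z3 (emb_Z3_Z6 t) = t" "proj_Z6_Z3 (emb_Z3_Z6 t + 3) = t" "emb_Z3_Z6 t + 3 \<notin> range emb_Z3_Z6"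
    unfolding r using t by (auto simp: emb_Z3_Z6_simps proj_Z6_Z3_def)
qed

lemma integer_group_dets_Z3_Z6:
  "integer_group_dets TYPE(Z3_Z6) =
    {group_det u * group_det v | u v :: 3 \<times> 3 \<Rightarrow> int. \<forall>x. u x mod 2 = v x mod 2}" (is "_ = ?R")
proof
  show "integer_group_dets TYPE(Z3_Z6) \<subseteq> ?R"
  proof
    fix D assume "D \<in> integer_group_dets TYPE(Z3_Z6)"
    then obtain a :: "3 \<times> 6 \<Rightarrow> int" where "D = group_det a"
      by (auto simp: integer_group_dets_def)
    then have "D = group_det (\<lambda>(k, t). a (k, emb_Z3_Z6 t) + a (k, emb_Z3_Z6 t + 3)) *
        group_det (\<lambda>(k, t). a (k, emb_Z3_Z6 t) - a (k, emb_Z3_Z6 t + 3))"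
      by (simp only: group_det_Z3_Z6)
    moreover have "(x + y) mod 2 = (x - y) mod 2" for x y :: int
      by presburger
    then have "\<forall>x. (\<lambda>(k, t). a (k, emb_Z3_Z6 t) + a (k, emb_Z3_Z6 t + 3)) x mod 2 =
        (\<lambda>(k, t). a (k, emb_Z3_Z6 t) - a (k, emb_Z3_Z6 t + 3)) x mod 2"
      by auto
    ultimately show "D \<in> ?R"
      by blast
  qed
  show "?R \<subseteq> integer_group_dets TYPE(Z3_Z6)"
  proof
    fix D assume "D \<in> ?R"
    then obtain u v :: "3 \<times> 3 \<Rightarrow> int" where D: "D = group_det u * group_det v"
      and uv: "\<And>x. u x mod 2 = v x mod 2"
      by blast
    \<comment> \<open>Solves the system with prescribed sum \<open>u\<close> and difference
      \<open>v\<close>; congruence modulo 2 makes the halves exact.\<close>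
    define a :: "3 \<times> 6 \<Rightarrow> int" where "a = (\<lambda>(k, l). if l \<in> range emb_Z3_Z6
      then (u (k, proj_Z6_Z3 l) + v (k, proj_Z6_Z3 l)) div 2 else (u (k, proj_Z6_Z3 l) - v (k, proj_Z6_Z3 l)) div 2)"
    have "x mod 2 = y mod 2 \<Longrightarrow> (x + y) div 2 + (x - y) div 2 = x"
      "x mod 2 = y mod 2 \<Longrightarrow> (x + y) div 2 - (x - y) div 2 = y" for x y :: int
      by presburger+
    then have "a (k, emb_Z3_Z6 t) + a (k, emb_Z3_Z6 t + 3) = u (k, t)" "a (k, emb_Z3_Z6 t) - a (k, emb_Z3_Z6 t + 3) = v (k, t)" for k t
      by (simp_all add: a_def proj_Z6_Z3_emb uv)
    then have "group_det a = D"
      by (simp add: group_det_Z3_Z6 D)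
    then show "D \<in> integer_group_dets TYPE(Z3_Z6)"
      by (auto simp: integer_group_dets_def)
  qed
qed

lemma Z3_Z6_dets_prodI:
  fixes u v :: "3 \<times> 3 \<Rightarrow> int"
  assumes "\<And>x. u x mod 2 = v x mod 2" "D = group_det u * group_det v"
  shows "D \<in> integer_group_dets TYPE(Z3_Z6)"
  unfolding integer_group_dets_Z3_Z6 using assms by blast

text \<open>Negating \<open>u\<close> alone keeps its parity and changes the sign of one
  factor.\<close>

lemma Z3_Z6_dets_uminus:
  assumes "D \<in> integer_group_dets TYPE(Z3_Z6)"
  shows "- D \<in> integer_group_dets TYPE(Z3_Z6)"
proof -
  obtain u v :: "3 \<times> 3 \<Rightarrow> int" where D: "D = group_det u * group_det v" and uv: "\<And>x. u x mod 2 = v x mod 2"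
    using assms unfolding integer_group_dets_Z3_Z6 by blast
  have "(- u x) mod 2 = v x mod 2" for x
    using uv[of x] by presburger
  then show ?thesis
    by (rule Z3_Z6_dets_prodI) (simp add: group_det_uminus D)
qed

lemma Z3_Z6_dets_sign:
  assumes "D \<in> integer_group_dets TYPE(Z3_Z6)" "s \<in> {1, -1}" "E = s * D"
  shows "E \<in> integer_group_dets TYPE(Z3_Z6)"
  using assms Z3_Z6_dets_uminus[OF assms(1)] by auto

lemma Z3_Z6_dets_shiftI:
  assumes "\<And>x. (u x + i) mod 2 = (v x + j) mod 2"
    and "D = ((coeff_sum u + 9 * i) * norm_prod u) * ((coeff_sum v + 9 * j) * norm_prod v)"
  shows "D \<in> integer_group_dets TYPE(Z3_Z6)"
  using assms by (intro Z3_Z6_dets_prodI[of "\<lambda>x. u x + i" "\<lambda>x. v x + j"]) (simp_all only: group_det_shift)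

section \<open>Realising all listed forms\<close>

definition rows :: "int \<times> int \<times> int \<Rightarrow> int \<times> int \<times> int \<Rightarrow> int \<times> int \<times> int \<Rightarrow> 3 \<times> 3 \<Rightarrow> int" where
  "rows r0 r1 r2 = (\<lambda>(k, l).
    let (a, b, c) = if k = 0 then r0 else if k = 1 then r1 else r2
    in if l = 0 then a else if l = 1 then b else c)"

lemma rows_simps:
  "rows (a, b, c) r1 r2 (0, 0) = a" "rows (a, b, c) r1 r2 (0, 1) = b" "rows (a, b, c) r1 r2 (0, 2) = c"
  "rows r0 (a, b, c) r2 (1, 0) = a" "rows r0 (a, b, c) r2 (1, 1) = b" "rows r0 (a, b, c) r2 (1, 2) = c"
  "rows r0 r1 (a, b, c) (2, 0) = a" "rows r0 r1 (a, b, c) (2, 1) = b" "rows r0 r1 (a, b, c) (2, 2) = c"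
  by (simp_all add: rows_def)

text \<open>Adding a constant \<open>j\<close> to all coefficients changes the determinant only through the augmentation,
  which grows by \<open>9 j\<close>. The elements below, found by a search, have norm product a power of 3 and
  so each yields a whole arithmetic progression of determinants.\<close>

definition "W0 = rows (1, 0, 0) (0, 0, 0) (0, 0, 0)"
definition "W6 = rows (1, 0, 0) (0, 0, 0) (0, 0, 2)"
definition "W8 = rows (-1, -2, 0) (-2, -2, -2) (0, 0, 0)"
definition "W12 = rows (1, 1, 1) (1, 0, 0) (0, 0, 2)"
definition "W12' = rows (-1, -1, 1) (1, 0, 0) (0, 0, 0)"

lemmas W_defs = W0_def W6_def W8_def W12_def W12'_def

lemma W_coeff_sum:
  "coeff_sum W0 = 1" "coeff_sum W6 = 3" "coeff_sum W8 = - 9" "coeff_sum W12 = 6" "coeff_sum W12' = 0"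
  by (simp_all add: coeff_sum_def W_defs rows_simps)

lemma W_norm_prod:
  "norm_prod W0 = 1" "norm_prod W6 = 3 ^ 5" "norm_prod W8 = 3 ^ 6" "norm_prod W12 = 3 ^ 5" "norm_prod W12' = 3 ^ 5"
  by (simp_all add: norm_prod_def Z3_norm_def W_defs rows_simps)

lemma W_parity:
  "W6 x mod 2 = W0 x mod 2" "W8 x mod 2 = W0 x mod 2" "W12 x mod 2 = W12' x mod 2"
proof -
  have "fst x \<in> {0, 1, 2}" "snd x \<in> {0, 1, 2}"
    unfolding UNIV_3'[symmetric] by simp_all
  then show "W6 x mod 2 = W0 x mod 2" "W8 x mod 2 = W0 x mod 2" "W12 x mod 2 = W12' x mod 2"
    by (cases x; auto simp: W_defs rows_simps)+
qed

lemma forms_i_subset: "forms_i \<subseteq> integer_group_dets TYPE(Z3_Z6)"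
proof
  fix D assume "D \<in> forms_i"
  then obtain s m :: int where s: "s \<in> {1, -1}" "D = s * (1 + 18 * m)"
    by (auto simp: forms_i_def)
  have "1 + 18 * m \<in> integer_group_dets TYPE(Z3_Z6)"
  proof (rule Z3_Z6_dets_shiftI[of W0 "2 * m" "W0" "0"])
    show "(W0 x + 2 * m) mod 2 = (W0 x + 0) mod 2" for x
      by simp
  qed (simp add: W_coeff_sum W_norm_prod)
  then show "D \<in> integer_group_dets TYPE(Z3_Z6)"
    using s by (rule Z3_Z6_dets_sign)
qed

lemma forms_ii_subset: "forms_ii \<subseteq> integer_group_dets TYPE(Z3_Z6)"
proof
  fix D assume "D \<in> forms_ii"
  then obtain s m k :: int where s: "s \<in> {1, -1}" "D = s * 4 * (4 + 9 * m) * (4 + 9 * k)"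
    by (auto simp: forms_ii_def)
  \<comment> \<open>An odd shift \<open>- 1 - 2 * m\<close> turns the augmentation 1 of
    \<open>W0\<close> into \<open>- 2 * (4 + 9 * m)\<close>; the two signs cancel.\<close>
  have "4 * (4 + 9 * m) * (4 + 9 * k) \<in> integer_group_dets TYPE(Z3_Z6)"
  proof (rule Z3_Z6_dets_shiftI[of W0 "(- 1 - 2 * m)" "W0" "(- 1 - 2 * k)"])
    show "(W0 x + (- 1 - 2 * m)) mod 2 = (W0 x + (- 1 - 2 * k)) mod 2" for x
      by presburger
  qed (simp add: W_coeff_sum W_norm_prod, algebra)
  then show "D \<in> integer_group_dets TYPE(Z3_Z6)"
    using s(1) by (rule Z3_Z6_dets_sign) (simp add: s(2) mult.assoc)
qed

lemma forms_iii_subset: "forms_iii \<subseteq> integer_group_dets TYPE(Z3_Z6)"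
proof -
  have 6: "3 ^ 6 * (1 + 6 * m) \<in> integer_group_dets TYPE(Z3_Z6)" for m
  proof (rule Z3_Z6_dets_shiftI[of W6 "2 * m" "W0" "0"])
    show "(W6 x + 2 * m) mod 2 = (W0 x + 0) mod 2" for x
      by (simp add: W_parity)
  qed (simp add: W_coeff_sum W_norm_prod)
  \<comment> \<open>The shift is \<open>2 * (m + 1)\<close> because \<open>W8\<close> has
    augmentation -9: the shifted value is \<open>9 * (1 + 2 * m)\<close>.\<close>
  have 8: "3 ^ 8 * (1 + 2 * m) \<in> integer_group_dets TYPE(Z3_Z6)" for m
  proof (rule Z3_Z6_dets_shiftI[of W8 "2 * (m + 1)" "W0" "0"])
    show "(W8 x + 2 * (m + 1)) mod 2 = (W0 x + 0) mod 2" for x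
      using W_parity(2)[of x] by presburger
  qed (simp add: W_coeff_sum W_norm_prod)
  show ?thesis
  proof
    fix D assume "D \<in> forms_iii"
    then consider s m where "s \<in> {1, -1}" "D = s * (3 ^ 6 * (1 + 6 * m))"
      | s m where "s \<in> {1, -1}" "D = s * (3 ^ 8 * (1 + 2 * m))"
      unfolding forms_iii_def mult.assoc by blast
    then show "D \<in> integer_group_dets TYPE(Z3_Z6)"
      by cases (fact Z3_Z6_dets_sign[OF 6], fact Z3_Z6_dets_sign[OF 8])
  qed
qed

lemma forms_iv_subset: "forms_iv \<subseteq> integer_group_dets TYPE(Z3_Z6)"
proof -
  \<comment> \<open>The shifted augmentations are \<open>- 6 * (1 + 3 * m)\<close> and
    \<open>- 2 * (4 + 9 * k)\<close>.\<close>
  have 6: "2\<^sup>2 * 3 ^ 6 * (1 + 3 * m) * (4 + 9 * k) \<in> integer_group_dets TYPE(Z3_Z6)" for m k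
  proof (rule Z3_Z6_dets_shiftI[of W6 "(- 1 - 2 * m)" "W0" "(- 1 - 2 * k)"])
    show "(W6 x + (- 1 - 2 * m)) mod 2 = (W0 x + (- 1 - 2 * k)) mod 2" for x
      using W_parity(1)[of x] by presburger
  qed (simp add: W_coeff_sum W_norm_prod, algebra)
  \<comment> \<open>The shift by \<open>1 - 2 * m\<close> cancels the augmentation -9 of
    \<open>W8\<close> and leaves \<open>- 18 * m\<close>.\<close>
  have 8: "2\<^sup>2 * 3 ^ 8 * m * (4 + 9 * k) \<in> integer_group_dets TYPE(Z3_Z6)" for m k
  proof (rule Z3_Z6_dets_shiftI[of W8 "(1 - 2 * m)" "W0" "(- 1 - 2 * k)"])
    show "(W8 x + (1 - 2 * m)) mod 2 = (W0 x + (- 1 - 2 * k)) mod 2" for x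
      using W_parity(2)[of x] by presburger
  qed (simp add: W_coeff_sum W_norm_prod, algebra)
  have 12: "2\<^sup>2 * 3 ^ 12 * m \<in> integer_group_dets TYPE(Z3_Z6)" for m
  proof -
    \<comment> \<open>Two shifts of \<open>W6\<close>, with augmentations -6 and
      \<open>6 * (2 + 3 * j)\<close>, give the negative of this number. Up to sign this covers every
      multiplier prime to 3.\<close>
    have a: "2\<^sup>2 * 3 ^ 12 * (2 + 3 * j) \<in> integer_group_dets TYPE(Z3_Z6)" for j
    proof (rule Z3_Z6_dets_uminus[of "- _", simplified minus_minus], rule Z3_Z6_dets_shiftI[of W6 "- 1" "W6" "(2 * j + 1)"])
      show "(W6 x + - 1) mod 2 = (W6 x + (2 * j + 1)) mod 2" for x
        by presburger
    qed (simp add: W_coeff_sum W_norm_prod)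
    consider k where "m = 3 * k" | k where "m = 2 + 3 * k" | k where "m = - (2 + 3 * k)"
    proof -
      have "m = 3 * (m div 3) \<or> m = 2 + 3 * (m div 3) \<or> m = - (2 + 3 * (- 1 - m div 3))"
        by presburger
      then show ?thesis using that by blast
    qed
    then show ?thesis
    proof cases
      case 1
      \<comment> \<open>Multipliers divisible by 3 come from the second congruent pair:
        augmentations 6 and \<open>18 * k\<close>, each with norm product
        \<open>3 ^ 5\<close>.\<close>
      show ?thesis
      proof (rule Z3_Z6_dets_shiftI[of W12 "0" "W12'" "2 * k"])
        show "(W12 x + 0) mod 2 = (W12' x + 2 * k) mod 2" for x
          by (simp add: W_parity)
      qed (simp add: W_coeff_sum W_norm_prod 1)
    next
      case 2
      then show ?thesis using a[of k] by simp
    next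
      case 3
      then show ?thesis using Z3_Z6_dets_uminus[OF a[of k]] by simp
    qed
  qed
  show ?thesis
    unfolding forms_iv_def using Z3_Z6_dets_sign[OF 6] 8 12
    by (auto simp: mult.assoc)
qed

section \<open>Every determinant has a listed form\<close>

lemma not_3_dvd_sign_form: "(n :: int) mod 3 \<noteq> 0 \<Longrightarrow> \<exists>s\<in>{1, -1}. \<exists>m. n = s * (1 + 3 * m)"
  by (rule bexI[of _ "if n mod 3 = 1 then 1 else - 1"]) (auto, presburger+)

lemma forms_i_I:
  assumes "odd D" "D mod 9 \<in> {1, 8}"
  shows "D \<in> forms_i"
proof -
  have "D = 1 * (1 + 18 * (D div 18)) \<or> D = - 1 * (1 + 18 * (- 1 - D div 18))"
    using assms by auto presburger+
  then show ?thesis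
    unfolding forms_i_def by blast
qed

text \<open>The residue modulo 18 is 8 or 10, that is, 8 or -8, and 8 is
  \<open>2 * 4\<close>.\<close>

lemma even_mod_9_form:
  fixes d :: int
  assumes "even d" "d mod 9 \<in> {1, 8}"
  obtains s m where "s \<in> {1, -1}" "d = s * 2 * (4 + 9 * m)"
proof -
  have "d = 1 * 2 * (4 + 9 * (d div 18)) \<or> d = - 1 * 2 * (4 + 9 * (- 1 - d div 18))"
    using assms by auto presburger+
  then show ?thesis
    using that by blast
qed

lemma forms_iii_I:
  assumes "odd D" "3 ^ 6 dvd D" "\<not> exactly_3_pow_7 D"
  shows "D \<in> forms_iii"
proof -
  obtain n where n: "D = 3 ^ 6 * n"
    using assms by blast
  have "odd n"
    using assms(1) by (simp add: n)
  show ?thesis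
  proof (cases "3 dvd n")
    case True
    then obtain k where k: "n = 3 * k" by blast
    have "D = 3 ^ 7 * k"
      by (simp add: n k)
    then have "3 dvd k"
      using assms(3) by (auto simp: exactly_3_pow_7_def)
    then obtain j where j: "k = 3 * j" by blast
    have "odd j"
      using \<open>odd n\<close> by (simp add: j k)
    then have "j = 1 + 2 * (j div 2)"
      by presburger
    then have "D = 1 * 3 ^ 8 * (1 + 2 * (j div 2))"
      by (simp add: n k j)
    then show ?thesis
      unfolding forms_iii_def by blast
  next
    case False
    have "n = 1 * (1 + 6 * (n div 6)) \<or> n = - 1 * (1 + 6 * (- 1 - n div 6))"
      using False \<open>odd n\<close> by presburger
    then have "D = 1 * 3 ^ 6 * (1 + 6 * (n div 6)) \<or> D = - 1 * 3 ^ 6 * (1 + 6 * (- 1 - n div 6))"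
      unfolding n by algebra
    then show ?thesis
      unfolding forms_iii_def by blast
  qed
qed

text \<open>The case of exactly one factor divisible by 3: \<open>e\<close> contributes
  \<open>2 * (4 + 9 * k)\<close> up to sign, and all powers of 3 lie in \<open>d\<close>.\<close>

lemma forms_iv_I:
  assumes D: "D = d * e" and e: "even e" "e mod 9 \<in> {1, 8}" and d: "even d" "3 ^ 6 dvd d"
    and "\<not> exactly_3_pow_7 D"
  shows "D \<in> forms_iv"
proof -
  obtain s k where s: "s \<in> {1, -1}" "e = s * 2 * (4 + 9 * k)"
    using e by (rule even_mod_9_form)
  obtain n' where "d = 3 ^ 6 * n'"
    using d by blast
  moreover from this obtain n where "n' = 2 * n"
    using d by auto
  ultimately have n: "d = 2 * 3 ^ 6 * n"
    by simp
  show ?thesis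
  proof (cases "3 dvd n")
    case True
    then obtain j where j: "n = 3 * j" by blast
    have "D = 3 ^ 7 * (s * 4 * (4 + 9 * k) * j)"
      by (simp add: D n j s)
    then have "3 dvd s * 4 * (4 + 9 * k) * j"
      using assms(6) unfolding exactly_3_pow_7_def by blast
    \<comment> \<open>As \<open>4 * (4 + 9 * k)\<close> is 1 modulo 3, the extra factor 3 must
      divide \<open>s * j\<close>; the sign \<open>s\<close> is absorbed into
      \<open>i\<close>.\<close>
    moreover have "s * 4 * (4 + 9 * k) * j = s * j + 3 * (s * j * (5 + 12 * k))"
      by algebra
    ultimately have "3 dvd s * j"
      by (metis dvd_add_left_iff dvd_triv_left)
    then obtain i where i: "s * j = 3 * i"
      by blast
    have "D = 2\<^sup>2 * 3 ^ 7 * (s * j) * (4 + 9 * k)"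
      by (simp add: D n j s)
    then have "D = 2\<^sup>2 * 3 ^ 8 * i * (4 + 9 * k)"
      unfolding i by simp
    then show ?thesis
      unfolding forms_iv_def by blast
  next
    case False
    then obtain r m where r: "r \<in> {1, -1}" "n = r * (1 + 3 * m)"
      using not_3_dvd_sign_form[of n] unfolding dvd_eq_mod_eq_0 by blast
    have "D = (r * s) * 2\<^sup>2 * 3 ^ 6 * (1 + 3 * m) * (4 + 9 * k)"
      by (simp add: D n s r)
    moreover have "r * s \<in> {1, -1}"
      using r s by auto
    ultimately show ?thesis
      unfolding forms_iv_def by blast
  qed
qed

lemma coprime_3_iff: "coprime D 3 \<longleftrightarrow> \<not> 3 dvd D" for D :: int
proof
  show "coprime D 3" if "\<not> 3 dvd D"
    using prime_imp_coprime[of 3 D] that by (simp add: coprime_commute)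
qed (auto simp: coprime_def)

lemma Z3_Z6_dets_cases:
  assumes "D \<in> integer_group_dets TYPE(Z3_Z6)"
  shows "odd D \<Longrightarrow> \<not> 3 dvd D \<Longrightarrow> D \<in> forms_i"
    and "even D \<Longrightarrow> \<not> 3 dvd D \<Longrightarrow> D \<in> forms_ii"
    and "odd D \<Longrightarrow> 3 dvd D \<Longrightarrow> \<not> exactly_3_pow_7 D \<Longrightarrow> D \<in> forms_iii"
    and "even D \<Longrightarrow> 3 dvd D \<Longrightarrow> \<not> exactly_3_pow_7 D \<Longrightarrow> D \<in> forms_iv"
proof -
  obtain u v :: "3 \<times> 3 \<Rightarrow> int" where D: "D = group_det u * group_det v" and uv: "\<And>x. u x mod 2 = v x mod 2"
    using assms unfolding integer_group_dets_Z3_Z6 by blast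
  define d e where "d = group_det u" and "e = group_det v"
  have D: "D = d * e"
    by (simp add: D d_def e_def)
  have par: "even d \<longleftrightarrow> even e"
    using group_det_mod[of u 2 v, OF uv] by (simp add: d_def e_def even_iff_mod_2_eq_zero)
  have mod9: "\<not> 3 dvd d \<Longrightarrow> d mod 9 \<in> {1, 8}" "\<not> 3 dvd e \<Longrightarrow> e mod 9 \<in> {1, 8}"
    unfolding d_def e_def by (rule group_det_Z3_Z3_mod_9; assumption)+
  have pow6: "3 dvd d \<Longrightarrow> 3 ^ 6 dvd d" "3 dvd e \<Longrightarrow> 3 ^ 6 dvd e"
    unfolding d_def e_def by (rule group_det_Z3_Z3_3_pow_6; assumption)+
  have three: "3 dvd D \<longleftrightarrow> 3 dvd d \<or> 3 dvd e"
    unfolding D by (rule prime_dvd_mult_iff) simp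
  show "D \<in> forms_i" if "odd D" "\<not> 3 dvd D"
  proof (rule forms_i_I)
    have "d mod 9 \<in> {1, 8}" "e mod 9 \<in> {1, 8}"
      using that mod9 three by blast+
    then show "D mod 9 \<in> {1, 8}"
      unfolding D by (auto simp flip: mod_mult_eq[of d 9 e])
  qed (rule that)
  show "D \<in> forms_ii" if "even D" "\<not> 3 dvd D"
  proof -
    have de: "even d" "even e" "d mod 9 \<in> {1, 8}" "e mod 9 \<in> {1, 8}"
      using that mod9 three par by (auto simp: D)
    obtain s m where s: "s \<in> {1, -1}" "d = s * 2 * (4 + 9 * m)"
      using de(1,3) by (rule even_mod_9_form)
    obtain r k where r: "r \<in> {1, -1}" "e = r * 2 * (4 + 9 * k)"
      using de(2,4) by (rule even_mod_9_form)
    have "D = (s * r) * 4 * (4 + 9 * m) * (4 + 9 * k)"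
      by (simp add: D s r)
    moreover have "s * r \<in> {1, -1}"
      using r s by auto
    ultimately show ?thesis
      unfolding forms_ii_def by blast
  qed
  show "D \<in> forms_iii" if "odd D" "3 dvd D" "\<not> exactly_3_pow_7 D"
  proof (rule forms_iii_I)
    show "3 ^ 6 dvd D"
      using that three pow6 unfolding D by (metis dvd_mult dvd_mult2)
  qed (use that in auto)
  show "D \<in> forms_iv" if "even D" "3 dvd D" "\<not> exactly_3_pow_7 D"
  proof -
    have de: "even d" "even e"
      using that par by (auto simp: D)
    have "3 dvd d \<or> 3 dvd e"
      using that three by blast
    then consider "3 dvd d" "3 dvd e" | "3 dvd d" "\<not> 3 dvd e" | "\<not> 3 dvd d" "3 dvd e"
      by blast
    then show ?thesis
    proof cases
      \<comment> \<open>Both factors are even multiples of \<open>3 ^ 6\<close>, which gives the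
        form with \<open>3 ^ 12\<close>.\<close>
      case 1
      have "2 * 3 ^ 6 dvd x" if "even x" "3 ^ 6 dvd x" for x :: int
      proof -
        from that(2) obtain n where n: "x = 3 ^ 6 * n"
          by blast
        then have "even n"
          using that by simp
        then show ?thesis
          unfolding n by auto
      qed
      then have "2 * 3 ^ 6 dvd d" "2 * 3 ^ 6 dvd e"
        using de pow6 1 by blast+
      then have "(2 * 3 ^ 6) * (2 * 3 ^ 6) dvd D"
        unfolding D by (rule mult_dvd_mono)
      then obtain m where "D = 2\<^sup>2 * 3 ^ 12 * m"
        by auto
      then show ?thesis
        unfolding forms_iv_def by blast
    next
      case 2
      then show ?thesis
        using D de mod9 pow6 that by (intro forms_iv_I[of D d e]) auto
    next
      case 3
      then show ?thesis
        using D de mod9 pow6 that by (intro forms_iv_I[of D e d]) auto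
    qed
  qed
qed

section \<open>Parity and 3-adic valuation of the listed forms\<close>

lemma forms_i_D:
  assumes "D \<in> forms_i"
  shows "odd D \<and> \<not> 3 dvd D"
proof -
  obtain s m where "s \<in> {1, -1}" "D = s * (1 + 18 * m)"
    using assms unfolding forms_i_def by blast
  then have "D = 1 + 18 * m \<or> D = - (1 + 18 * m)"
    by auto
  then show ?thesis
    by presburger
qed

lemma not_3_dvd_4_plus: "\<not> 3 dvd 4 + 9 * k" for k :: int
  by presburger

lemma not_3_dvd_sign: "s \<in> {1, -1} \<Longrightarrow> \<not> 3 dvd s" for s :: int
  by auto

lemma forms_ii_D:
  assumes "D \<in> forms_ii"
  shows "even D \<and> \<not> 3 dvd D"
proof -
  obtain s m k where s: "s \<in> {1, -1}" and D: "D = s * 4 * (4 + 9 * m) * (4 + 9 * k)"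
    using assms unfolding forms_ii_def by blast
  have p: "prime (3 :: int)" and "\<not> 3 dvd (4 :: int)"
    by simp_all
  then have "\<not> 3 dvd D"
    using not_3_dvd_sign[OF s] not_3_dvd_4_plus unfolding D prime_dvd_mult_iff[OF p] by blast
  then show ?thesis
    by (simp add: D)
qed

lemma not_exactly_3_pow_7_mult_6: "\<not> 3 dvd n \<Longrightarrow> \<not> exactly_3_pow_7 (3 ^ 6 * n)"
  by (auto simp: exactly_3_pow_7_def)

text \<open>Cancelling \<open>3 ^ 7\<close> leaves the cofactor \<open>3 * n\<close>, a multiple of
  3; this includes the value 0.\<close>

lemma not_exactly_3_pow_7_mult_8: "\<not> exactly_3_pow_7 (3 ^ 8 * n)"
  by (auto simp: exactly_3_pow_7_def)

lemma forms_iii_D: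
  assumes "D \<in> forms_iii"
  shows "odd D \<and> 3 dvd D \<and> \<not> exactly_3_pow_7 D"
proof -
  from assms obtain s m where s: "s \<in> {1, -1}"
    and "D = s * 3 ^ 6 * (1 + 6 * m) \<or> D = s * 3 ^ 8 * (1 + 2 * m)"
    unfolding forms_iii_def by blast
  then have "D = 3 ^ 6 * (s * (1 + 6 * m)) \<or> D = 3 ^ 8 * (s * (1 + 2 * m))"
    by algebra
  moreover have "odd (s * (1 + 6 * m)) \<and> \<not> 3 dvd s * (1 + 6 * m)" "odd (s * (1 + 2 * m))"
    using s by auto presburger+
  ultimately obtain n where "odd n" "D = 3 ^ 6 * n \<and> \<not> 3 dvd n \<or> D = 3 ^ 8 * n"
    by blast
  then show ?thesis
    using not_exactly_3_pow_7_mult_6[of n] not_exactly_3_pow_7_mult_8[of n] by auto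
qed

lemma forms_iv_D:
  assumes "D \<in> forms_iv"
  shows "even D \<and> 3 dvd D \<and> \<not> exactly_3_pow_7 D"
proof -
  from assms consider
      s m k :: int where "s \<in> {1, -1}" "D = s * 2\<^sup>2 * 3 ^ 6 * (1 + 3 * m) * (4 + 9 * k)"
    | m k :: int where "D = 2\<^sup>2 * 3 ^ 8 * m * (4 + 9 * k)"
    | m :: int where "D = 2\<^sup>2 * 3 ^ 12 * m"
    unfolding forms_iv_def by blast
  then show ?thesis
  proof cases
    case 1
    have p: "prime (3 :: int)" and "\<not> 3 dvd (4 :: int)" "\<not> 3 dvd 1 + 3 * m"
      by (simp_all, presburger)
    then have "\<not> 3 dvd s * 4 * (1 + 3 * m) * (4 + 9 * k)"
      using not_3_dvd_sign[OF 1(1)] not_3_dvd_4_plus unfolding prime_dvd_mult_iff[OF p] by blast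
    moreover have "D = 3 ^ 6 * (s * 4 * (1 + 3 * m) * (4 + 9 * k))"
      unfolding 1 by algebra
    ultimately show ?thesis
      using not_exactly_3_pow_7_mult_6[of "s * 4 * (1 + 3 * m) * (4 + 9 * k)"] by simp
  next
    case 2
    have "D = 3 ^ 8 * (4 * m * (4 + 9 * k))"
      unfolding 2 by algebra
    then show ?thesis
      using not_exactly_3_pow_7_mult_8[of "4 * m * (4 + 9 * k)"] by simp
  next
    case 3
    have "D = 3 ^ 8 * (4 * 3 ^ 4 * m)"
      unfolding 3 by algebra
    then show ?thesis
      using not_exactly_3_pow_7_mult_8[of "4 * 3 ^ 4 * m"] by simp
  qed
qed

theorem theorem1:
  "(\<forall>D. \<not> exactly_3_pow_7 D \<longrightarrow>
      (D \<in> integer_group_dets TYPE(Z3_Z6) \<longleftrightarrow>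
       D \<in> forms_i \<union> forms_ii \<union> forms_iii \<union> forms_iv))
   \<and> {D \<in> integer_group_dets TYPE(Z3_Z6). odd D \<and> coprime D 3} = forms_i
   \<and> {D \<in> integer_group_dets TYPE(Z3_Z6). even D \<and> coprime D 3} = forms_ii
   \<and> {D \<in> integer_group_dets TYPE(Z3_Z6). odd D \<and> 3 dvd D \<and> \<not> exactly_3_pow_7 D} = forms_iii
   \<and> {D \<in> integer_group_dets TYPE(Z3_Z6). even D \<and> 3 dvd D \<and> \<not> exactly_3_pow_7 D} = forms_iv"
proof -
  note D = forms_i_D forms_ii_D forms_iii_D forms_iv_D
  note sub = forms_i_subset forms_ii_subset forms_iii_subset forms_iv_subset
  note cases = Z3_Z6_dets_cases
  have "{D \<in> integer_group_dets TYPE(Z3_Z6). odd D \<and> coprime D 3} = forms_i"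
    using D(1) sub(1) cases(1) unfolding coprime_3_iff by blast
  moreover have "{D \<in> integer_group_dets TYPE(Z3_Z6). even D \<and> coprime D 3} = forms_ii"
    using D(2) sub(2) cases(2) unfolding coprime_3_iff by blast
  moreover have "{D \<in> integer_group_dets TYPE(Z3_Z6). odd D \<and> 3 dvd D \<and> \<not> exactly_3_pow_7 D} = forms_iii"
    using D(3) sub(3) cases(3) by blast
  moreover have "{D \<in> integer_group_dets TYPE(Z3_Z6). even D \<and> 3 dvd D \<and> \<not> exactly_3_pow_7 D} = forms_iv"
    using D(4) sub(4) cases(4) by blast
  moreover have "D \<in> integer_group_dets TYPE(Z3_Z6) \<longleftrightarrow> D \<in> forms_i \<union> forms_ii \<union> forms_iii \<union> forms_iv"
    if "\<not> exactly_3_pow_7 D" for D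
    using sub cases[of D] that by blast
  ultimately show ?thesis
    by blast
qed

end
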